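(* There is an absolute constant $K$ such that for every code $C\subseteq\{0,1\}^m$ and every $\epsilon\in(0,1)$, there exists a $(1\pm\epsilon)$-sparsifier $\widetilde w$ of $C$ with respect to the all-ones weights $w\equiv 1$ with $|\operatorname{supp}(\widetilde w)|\le K\cdot \mathrm{CL}(C)\log^2(m)(\log\log m)^2/\epsilon^2$.
   Context: A chain of length $\ell$ in a code $C\subseteq\{0,1\}^m$ is a pair of injective maps $a:[\ell]\to[m]$ and $c:[\ell]\to C$ such that $c(i)_{a(i)}=1$ for all $i$, and $c(i)_{a(j)}=0$ for all $1\le i<j\le\ell$; the chain length $\mathrm{CL}(C)$ is the maximum length of a chain ($0$ if none exists). Given weights $w:[m]\to\mathbb{R}_{\ge0}$ and $\epsilon>0$, a $(1\pm\epsilon)$-sparsifier of $C$ with respect to $w$ is $\widetilde w:[m]\to\mathbb{R}_{\ge0}$ with $(1-\epsilon)\sum_i w(i)c_i\le\sum_i\widetilde w(i)c_i\le(1+\epsilon)\sum_i w(i)c_i$ for every $c\in C$; $\operatorname{supp}(\widetilde w)=\{i:\widetilde w(i)\neq0\}$. Logarithms are understood to be at least $1$, i.e. $\log x:=\max\{\log_2 x,1\}$. *)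

theory Defs
  imports Complex_Main
begin

text \<open>A code C in {0,1}^m is represented as a set of codewords, each codeword being
  its support, a subset of the coordinate set {0..<m} (so c_i = 1 iff i is in c).\<close>

definition is_code :: "nat \<Rightarrow> nat set set \<Rightarrow> bool" where
  "is_code m C \<longleftrightarrow> (\<forall>c\<in>C. c \<subseteq> {..<m})"

definition is_chain :: "nat \<Rightarrow> nat set set \<Rightarrow> nat \<Rightarrow> (nat \<Rightarrow> nat) \<Rightarrow> (nat \<Rightarrow> nat set) \<Rightarrow> bool" where
  "is_chain m C l a c \<longleftrightarrow>
     inj_on a {..<l} \<and> a ` {..<l} \<subseteq> {..<m} \<and>
     inj_on c {..<l} \<and> c ` {..<l} \<subseteq> C \<and>
     (\<forall>i<l. a i \<in> c i) \<and>
     (\<forall>i j. i < j \<and> j < l \<longrightarrow> a j \<notin> c i)"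

definition chain_length :: "nat \<Rightarrow> nat set set \<Rightarrow> nat" where
  "chain_length m C = Max {l. \<exists>a c. is_chain m C l a c}"

definition wsum :: "nat \<Rightarrow> (nat \<Rightarrow> real) \<Rightarrow> nat set \<Rightarrow> real" where
  "wsum m w c = (\<Sum>i\<in>{..<m} \<inter> c. w i)"

definition is_sparsifier :: "nat \<Rightarrow> nat set set \<Rightarrow> (nat \<Rightarrow> real) \<Rightarrow> real \<Rightarrow> (nat \<Rightarrow> real) \<Rightarrow> bool" where
  "is_sparsifier m C w \<epsilon> w' \<longleftrightarrow>
     (\<forall>i<m. w' i \<ge> 0) \<and>
     (\<forall>c\<in>C. (1 - \<epsilon>) * wsum m w c \<le> wsum m w' c \<and> wsum m w' c \<le> (1 + \<epsilon>) * wsum m w c)"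

definition supp_w :: "nat \<Rightarrow> (nat \<Rightarrow> real) \<Rightarrow> nat set" where
  "supp_w m w' = {i\<in>{..<m}. w' i \<noteq> 0}"

definition lg :: "real \<Rightarrow> real" where
  "lg x = max (log 2 x) 1"

end

(* Karger-style contraction with the chain length in the role of dimension: restricting a code to
   the words avoiding a support point lowers the chain length, and the chain length of a contraction
   and that of the puncturing along its support add up to at most that of the code. Removing at most
   d * CL coordinates therefore leaves a code all of whose contractions have support at least
   d * CL; such a code has only m^(2a) words of weight at most a * d, and none of weight strictly
   between 0 and d, so sampling its coordinates at rate about ln m / (delta^2 d) preserves
   all weights up to 1 +- delta. With d balanced so that the removed part and the sample have
   comparable sizes, the excess ratio drops to its square root in each of them, and recursing on both
   for loglog m levels with delta = eps / (2 loglog m) ends with about log m pieces of size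
   CL * ln m / delta^2. *)
theory Submission
  imports Defs
begin

section \<open>Chains without coordinates, and the chain length \<open>cl\<close>\<close>

text \<open>The chains of the theorem with the coordinates \<open>a i\<close> forgotten: any point
  of a word outside all earlier words can serve as its coordinate. \<open>U\<close> collects what is
  already covered, so that appending and puncturing both become a change of
  \<open>U\<close>.\<close>

fun uchain :: "'a set \<Rightarrow> 'a set list \<Rightarrow> bool" where
  "uchain U [] \<longleftrightarrow> True"
| "uchain U (c # cs) \<longleftrightarrow> \<not> c \<subseteq> U \<and> uchain (U \<union> c) cs"

lemma uchain_append:
  "uchain U (xs @ ys) \<longleftrightarrow> uchain U xs \<and> uchain (U \<union> \<Union>(set xs)) ys"
  by (induction xs arbitrary: U) (auto simp: Un_assoc)

lemma uchain_antimono: "uchain V cs \<Longrightarrow> U \<subseteq> V \<Longrightarrow> uchain U cs"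
proof (induction cs arbitrary: U V)
  case (Cons c cs)
  have "uchain (U \<union> c) cs"
    by (rule Cons.IH[of "V \<union> c"]) (use Cons.prems in auto)
  then show ?case using Cons.prems by auto
qed simp

text \<open>Lifts a chain of a punctured code back to the original words: removing \<open>U\<close>
  from every word has the same effect as counting \<open>U\<close> as covered from the
  start.\<close>

lemma uchain_map_Diff: "uchain V (map (\<lambda>c. c - U) cs) \<longleftrightarrow> uchain (U \<union> V) cs"
proof (induction cs arbitrary: V)
  case (Cons c cs)
  have "U \<union> (V \<union> (c - U)) = U \<union> V \<union> c" by auto
  then show ?case using Cons[of "V \<union> (c - U)"] by auto
qed simp

lemma uchain_distinct:
  assumes "uchain U cs"
  shows "distinct cs \<and> (\<forall>c\<in>set cs. \<not> c \<subseteq> U)"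
  using assms
proof (induction cs arbitrary: U)
  case (Cons c cs)
  then show ?case using Cons.IH[of "U \<union> c"] by auto
qed simp

lemma uchain_nth:
  assumes "uchain U cs" "j < length cs"
  shows "\<not> cs ! j \<subseteq> U \<union> (\<Union>i<j. cs ! i)"
  using assms
proof (induction cs arbitrary: U j)
  case (Cons c cs)
  show ?case
  proof (cases j)
    case 0
    then show ?thesis using Cons by auto
  next
    case (Suc k)
    then have "\<not> cs ! k \<subseteq> (U \<union> c) \<union> (\<Union>i<k. cs ! i)"
      using Cons.prems by (intro Cons.IH) auto
    moreover have "(\<Union>i<Suc k. (c # cs) ! i) = c \<union> (\<Union>i<k. cs ! i)"
      by (subst lessThan_Suc_eq_insert_0) auto
    ultimately show ?thesis using Suc by (simp add: Un_assoc)
  qed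
qed simp

definition cl :: "'a set set \<Rightarrow> nat" where
  "cl C = Max {length cs | cs. set cs \<subseteq> C \<and> uchain {} cs}"

lemma finite_cl:
  assumes "finite C"
  shows "finite {length cs | cs. set cs \<subseteq> C \<and> uchain {} cs}"
proof (rule finite_subset)
  show "{length cs | cs. set cs \<subseteq> C \<and> uchain {} cs} \<subseteq> {..card C}"
  proof
    fix l assume "l \<in> {length cs | cs. set cs \<subseteq> C \<and> uchain {} cs}"
    then obtain cs where cs: "l = length cs" "set cs \<subseteq> C" "uchain {} cs" by blast
    then have "length cs = card (set cs)" using uchain_distinct distinct_card by metis
    then show "l \<in> {..card C}" using cs(1,2) assms by (simp add: card_mono)
  qed
qed simp

lemma le_cl:
  assumes "finite C" "set cs \<subseteq> C" "uchain {} cs"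
  shows "length cs \<le> cl C"
  unfolding cl_def using assms by (intro Max_ge finite_cl) auto

lemma cl_attained:
  assumes "finite C"
  obtains cs where "set cs \<subseteq> C" "uchain {} cs" "length cs = cl C"
proof -
  have "{length cs | cs. set cs \<subseteq> C \<and> uchain {} cs} \<noteq> {}"
    by (auto intro!: exI[of _ "[]"])
  from Max_in[OF finite_cl[OF assms] this] show ?thesis
    unfolding cl_def[symmetric] using that by auto
qed

lemma cl_pos:
  assumes "finite C" "c \<in> C" "c \<noteq> {}"
  shows "1 \<le> cl C"
  using le_cl[of C "[c]"] assms by auto

lemma subset_image_mapE:
  assumes "set zs \<subseteq> f ` C"
  obtains ys where "set ys \<subseteq> C" "zs = map f ys"
proof -
  have "zs \<in> map f ` lists C" using assms unfolding lists_image[symmetric] by auto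
  then show ?thesis using that by auto
qed

text \<open>A longest chain of \<open>C1\<close> stays inside \<open>\<Union>C1\<close>, while each
  word of a chain of the punctured code brings a point outside it. So the second chain, lifted to
  \<open>C\<close>, can be appended to the first.\<close>

lemma cl_concat:
  assumes "finite C" "C1 \<subseteq> C"
  shows "cl C1 + cl ((\<lambda>c. c - \<Union>C1) ` C) \<le> cl C"
proof -
  have fin: "finite C1" using assms finite_subset by blast
  obtain xs where xs: "set xs \<subseteq> C1" "uchain {} xs" "length xs = cl C1"
    using cl_attained[OF fin] .
  obtain zs where zs: "set zs \<subseteq> (\<lambda>c. c - \<Union>C1) ` C" "uchain {} zs"
    "length zs = cl ((\<lambda>c. c - \<Union>C1) ` C)"
    using cl_attained[OF finite_imageI[OF assms(1)]] .
  obtain ys where ys: "set ys \<subseteq> C" "zs = map (\<lambda>c. c - \<Union>C1) ys"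
    using subset_image_mapE[OF zs(1)] .
  have "uchain (\<Union>C1) ys"
    using zs(2) ys(2) uchain_map_Diff[of "{}" "\<Union>C1" ys] by simp
  moreover have "{} \<union> \<Union>(set xs) \<subseteq> \<Union>C1" using xs(1) by auto
  ultimately have "uchain ({} \<union> \<Union>(set xs)) ys" by (rule uchain_antimono)
  then have "uchain {} (xs @ ys)" unfolding uchain_append using xs(2) by blast
  then have "length (xs @ ys) \<le> cl C"
    using assms xs(1) ys(1) by (intro le_cl) auto
  then show ?thesis using xs(3) ys(2) zs(3) by simp
qed

lemma cl_image_Diff_le:
  assumes "finite C"
  shows "cl ((\<lambda>c. c - U) ` C) \<le> cl C"
proof -
  obtain zs where zs: "set zs \<subseteq> (\<lambda>c. c - U) ` C" "uchain {} zs"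
    "length zs = cl ((\<lambda>c. c - U) ` C)"
    using cl_attained[OF finite_imageI[OF assms(1)]] .
  obtain ys where ys: "set ys \<subseteq> C" "zs = map (\<lambda>c. c - U) ys"
    using subset_image_mapE[OF zs(1)] .
  have "uchain U ys"
    using zs(2) ys(2) uchain_map_Diff[of "{}" U ys] by simp
  then have "uchain {} ys" by (rule uchain_antimono) simp
  then show ?thesis using le_cl[OF assms ys(1)] ys(2) zs(3) by simp
qed

text \<open>A word through \<open>j\<close> does not become empty when the support of the words
  avoiding \<open>j\<close> is removed, so in \<open>cl_concat\<close> the punctured code
  contributes at least 1.\<close>

lemma cl_avoid_less:
  assumes "finite C" "j \<in> \<Union>C"
  shows "cl {c \<in> C. j \<notin> c} < cl C"
proof -
  let ?C1 = "{c \<in> C. j \<notin> c}"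
  obtain c where c: "c \<in> C" "j \<in> c" using assms by auto
  have "1 \<le> cl ((\<lambda>c. c - \<Union>?C1) ` C)"
    by (rule cl_pos[of _ "c - \<Union>?C1"]) (use c assms in auto)
  then show ?thesis using cl_concat[OF assms(1), of ?C1] by simp
qed

text \<open>Transfers bounds in terms of \<open>cl\<close> to the given chain length. The
  coordinates are recovered by choosing in each word a point outside the earlier ones; they are
  distinct because \<open>a i\<close> lies in word \<open>i\<close> and no later \<open>a j\<close>
  does.\<close>

lemma cl_le_chain_length:
  assumes code: "is_code m C"
  shows "cl C \<le> chain_length m C"
proof -
  have fin: "finite C"
    using code by (auto simp: is_code_def intro: finite_subset[of _ "Pow {..<m}"])
  obtain cs where cs: "set cs \<subseteq> C" "uchain {} cs" "length cs = cl C"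
    using cl_attained[OF fin] .
  define a where "a j = (SOME x. x \<in> cs ! j \<and> x \<notin> (\<Union>i<j. cs ! i))" for j
  have a: "a j \<in> cs ! j \<and> a j \<notin> (\<Union>i<j. cs ! i)" if "j < cl C" for j
    unfolding a_def by (rule someI_ex) (use uchain_nth[OF cs(2), of j] that cs(3) in auto)
  have "is_chain m C (cl C) a (\<lambda>i. cs ! i)"
    unfolding is_chain_def
  proof (intro conjI allI impI)
    show "inj_on a {..<cl C}"
    proof (rule linorder_inj_onI')
      fix i j assume "i \<in> {..<cl C}" "j \<in> {..<cl C}" "i < j"
      then have "a i \<in> cs ! i" "a j \<notin> cs ! i" using a by auto
      then show "a i \<noteq> a j" by auto
    qed
    show "inj_on (\<lambda>i. cs ! i) {..<cl C}"
      using uchain_distinct[OF cs(2)] cs(3) by (auto simp: inj_on_def nth_eq_iff_index_eq)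
    show sub: "(\<lambda>i. cs ! i) ` {..<cl C} \<subseteq> C"
      using cs(1,3) nth_mem by (metis image_subsetI lessThan_iff subsetD)
    show "a ` {..<cl C} \<subseteq> {..<m}"
    proof (rule image_subsetI)
      fix i assume "i \<in> {..<cl C}"
      then have "a i \<in> cs ! i" "cs ! i \<in> C" using a sub by auto
      then show "a i \<in> {..<m}" using code by (auto simp: is_code_def)
    qed
  qed (use a in auto)
  \<comment> \<open>Injectivity of \<open>a\<close> bounds every chain by \<open>m\<close>, so the
    \<open>Max\<close> in \<open>chain_length\<close> is over a finite set.\<close>
  moreover have "finite {l. \<exists>a c. is_chain m C l a c}"
  proof (rule finite_subset)
    show "{l. \<exists>a c. is_chain m C l a c} \<subseteq> {..m}"
    proof
      fix l assume "l \<in> {l. \<exists>a c. is_chain m C l a c}"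
      then obtain a c where "is_chain m C l a c" by blast
      then show "l \<in> {..m}" using card_inj_on_le[of a "{..<l}" "{..<m}"] by (auto simp: is_chain_def)
    qed
  qed simp
  ultimately show ?thesis unfolding chain_length_def by (intro Max_ge) auto
qed

section \<open>Dense codes: contractions with large support\<close>

text \<open>The words avoiding \<open>J\<close> form the contraction of \<open>C\<close> by
  \<open>J\<close>. Quantifying over all \<open>J\<close> makes the property pass to contractions;
  \<open>d\<close> plays the part of the minimum cut in Karger's cut counting.\<close>

definition dense :: "real \<Rightarrow> 'a set set \<Rightarrow> bool" where
  "dense d C \<longleftrightarrow>
     (\<forall>J. d * real (cl {c \<in> C. c \<inter> J = {}}) \<le> real (card (\<Union>{c \<in> C. c \<inter> J = {}})))"

lemma dense_avoid:
  assumes "dense d C"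
  shows "dense d {c \<in> C. j \<notin> c}"
  unfolding dense_def
proof
  fix J
  have "{c \<in> {c \<in> C. j \<notin> c}. c \<inter> J = {}} = {c \<in> C. c \<inter> insert j J = {}}" by auto
  then show "d * real (cl {c \<in> {c \<in> C. j \<notin> c}. c \<inter> J = {}})
      \<le> real (card (\<Union>{c \<in> {c \<in> C. j \<notin> c}. c \<inter> J = {}}))"
    using spec[OF assms[unfolded dense_def], of "insert j J"] by (simp only:)
qed

lemma dense_support:
  assumes "dense d C"
  shows "d * real (cl C) \<le> real (card (\<Union>C))"
  using spec[OF assms[unfolded dense_def], of "{}"] by simp

text \<open>Contract by the complement of \<open>c\<close>: the words left all lie inside
  \<open>c\<close>, and \<open>c\<close> is one of them, so their support is \<open>c\<close> and
  their chain length at least 1.\<close>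

lemma dense_word:
  assumes "dense d C" "finite C" "c \<in> C" "c \<noteq> {}" "0 \<le> d"
  shows "d \<le> real (card c)"
proof -
  let ?D = "{c' \<in> C. c' \<inter> (- c) = {}}"
  have "\<Union>?D = c" using assms(3) by auto
  moreover have "1 \<le> cl ?D" using assms by (intro cl_pos[of _ c]) auto
  then have "d * 1 \<le> d * real (cl ?D)" using assms(5) by (intro mult_left_mono) auto
  moreover have "d * real (cl ?D) \<le> real (card (\<Union>?D))"
    using assms(1) unfolding dense_def by blast
  ultimately show ?thesis by simp
qed

text \<open>While some contraction \<open>C1\<close> has too small a support, delete that support.
  This costs less than \<open>d * cl C1\<close> points and lowers \<open>cl\<close> by at least
  \<open>cl C1\<close> (\<open>cl_concat\<close>), so the costs add up to at most
  \<open>d * cl C\<close>.\<close>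

lemma dense_decomposition:
  assumes "finite C" "\<And>c. c \<in> C \<Longrightarrow> finite c" "0 \<le> d"
  obtains T where "T \<subseteq> \<Union>C" "real (card T) \<le> d * real (cl C)" "dense d ((\<lambda>c. c - T) ` C)"
proof -
  have "\<exists>T. T \<subseteq> \<Union>C \<and> real (card T) \<le> d * real (cl C) \<and> dense d ((\<lambda>c. c - T) ` C)"
    using assms(1,2)
  proof (induction "cl C" arbitrary: C rule: less_induct)
    case less
    show ?case
    proof (cases "dense d C")
      case True
      then show ?thesis using assms(3) by (intro exI[of _ "{}"]) auto
    next
      case False
      then obtain J where J: "real (card (\<Union>{c \<in> C. c \<inter> J = {}})) < d * real (cl {c \<in> C. c \<inter> J = {}})"
        unfolding dense_def by (auto simp: not_le)
      define C1 where "C1 = {c \<in> C. c \<inter> J = {}}"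
      define D where "D = (\<lambda>c. c - \<Union>C1) ` C"
      have le: "cl C1 + cl D \<le> cl C"
        unfolding D_def by (rule cl_concat) (use less in \<open>auto simp: C1_def\<close>)
      have "cl C1 \<noteq> 0" using J by (intro notI) (simp add: C1_def)
      then have "cl D < cl C" using le by simp
      moreover have "finite D" "\<And>c. c \<in> D \<Longrightarrow> finite c" using less.prems by (auto simp: D_def)
      ultimately obtain T where T: "T \<subseteq> \<Union>D" "real (card T) \<le> d * real (cl D)"
          "dense d ((\<lambda>c. c - T) ` D)"
        using less.hyps[of D] by blast
      have "(\<lambda>c. c - T) ` D = (\<lambda>c. c - (\<Union>C1 \<union> T)) ` C"
        unfolding D_def image_image by (simp add: Diff_eq Int_assoc)
      moreover have "real (card (\<Union>C1 \<union> T)) \<le> d * real (cl C)"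
      proof -
        have "real (card (\<Union>C1 \<union> T)) \<le> real (card (\<Union>C1)) + real (card T)"
          using card_Un_le[of "\<Union>C1" T] by linarith
        also have "\<dots> \<le> d * real (cl C1) + d * real (cl D)"
          using J T(2) by (simp add: C1_def)
        also have "\<dots> \<le> d * real (cl C)"
          using le assms(3) by (simp flip: distrib_left of_nat_add add: mult_left_mono)
        finally show ?thesis .
      qed
      moreover have "\<Union>C1 \<union> T \<subseteq> \<Union>C"
        using T(1) by (auto simp: C1_def D_def)
      ultimately show ?thesis using T(3) by metis
    qed
  qed
  then show ?thesis using that by blast
qed

section \<open>Counting words, in particular light ones\<close>

text \<open>A Sauer-Shelah type bound. Every word except the full support misses some support point
  \<open>j\<close>, and the words missing \<open>j\<close> have smaller \<open>cl\<close>; hence the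
  recurrence N(l) \<le> 1 + |U| * N(l - 1).\<close>

lemma card_le_power_cl:
  assumes "finite C" "\<Union>C \<subseteq> U" "finite U"
  shows "card C \<le> (card U + 1) ^ cl C"
  using assms(1,2)
proof (induction "cl C" arbitrary: C rule: less_induct)
  case less
  have cover: "C \<subseteq> {\<Union>C} \<union> (\<Union>j\<in>\<Union>C. {c \<in> C. j \<notin> c})" by auto
  have finU: "finite (\<Union>C)" using less.prems assms(3) finite_subset by blast
  show ?case
  proof (cases "\<Union>C = {}")
    case True
    then have "C \<subseteq> {{}}" by auto
    then have "card C \<le> 1" using card_mono[of "{{}}" C] by simp
    also have "1 \<le> (card U + 1) ^ cl C" by (rule one_le_power) simp
    finally show ?thesis .
  next
    case False
    then obtain j where "j \<in> \<Union>C" by blast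
    then have "cl C \<noteq> 0" using cl_avoid_less[OF less.prems(1), of j] by linarith
    then obtain r where r: "cl C = Suc r" using not0_implies_Suc by blast
    have bd: "card {c \<in> C. j \<notin> c} \<le> (card U + 1) ^ r" if "j \<in> \<Union>C" for j
    proof -
      have lt: "cl {c \<in> C. j \<notin> c} < cl C" by (rule cl_avoid_less[OF less.prems(1) that])
      then have "card {c \<in> C. j \<notin> c} \<le> (card U + 1) ^ cl {c \<in> C. j \<notin> c}"
        using less.prems by (intro less.hyps) auto
      also have "\<dots> \<le> (card U + 1) ^ r" using lt r by (intro power_increasing) auto
      finally show ?thesis .
    qed
    have "card C \<le> card ({\<Union>C} \<union> (\<Union>j\<in>\<Union>C. {c \<in> C. j \<notin> c}))"
      by (rule card_mono[OF finite_subset[of _ "insert (\<Union>C) C"] cover])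
        (use less.prems(1) in auto)
    also have "\<dots> \<le> 1 + card (\<Union>j\<in>\<Union>C. {c \<in> C. j \<notin> c})"
      by (rule le_trans[OF card_Un_le]) simp
    also have "\<dots> \<le> 1 + (\<Sum>j\<in>\<Union>C. card {c \<in> C. j \<notin> c})"
      by (intro add_left_mono card_UN_le finU)
    also have "\<dots> \<le> 1 + card (\<Union>C) * (card U + 1) ^ r"
      using sum_bounded_above[of "\<Union>C" "\<lambda>j. card {c \<in> C. j \<notin> c}", OF bd]
      by (simp del: UN_iff Union_iff)
    also have "\<dots> \<le> (card U + 1) ^ r + card U * (card U + 1) ^ r"
      using card_mono[OF assms(3) less.prems(2)] by (intro add_mono mult_right_mono one_le_power) auto
    finally show ?thesis by (simp add: r)
  qed
qed

text \<open>The derandomised form of a contraction argument: a word of size at most \<open>\<alpha> d\<close> avoids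
  a uniformly random point of the support with probability at least \<open>1 - \<alpha> / cl C\<close>.\<close>

lemma card_light_words_binomial:
  assumes "finite C" "\<Union>C \<subseteq> U" "finite U" "dense d C" "0 < d"
  shows "real (card {c \<in> C. real (card c) \<le> real \<alpha> * d})
           \<le> real ((max \<alpha> (cl C)) choose \<alpha>) * real (card U + 1) ^ \<alpha>"
  using assms(1,2,4)
proof (induction "cl C" arbitrary: C rule: less_induct)
  case less
  define l n where "l = cl C" and "n = card (\<Union>C)"
  define L where "L D = {c \<in> D. real (card c) \<le> real \<alpha> * d}" for D :: "'a set set"
  have finU: "finite (\<Union>C)" using less.prems assms(3) finite_subset by blast
  show ?case
  proof (cases "l \<le> \<alpha>")
    \<comment> \<open>Base case: the \<open>max\<close> makes the binomial 1, and counting all the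
      words already gives the bound.\<close>
    case True
    have "card (L C) \<le> card C" unfolding L_def using less.prems by (intro card_mono) auto
    also have "\<dots> \<le> (card U + 1) ^ l"
      unfolding l_def using less.prems assms(3) by (intro card_le_power_cl)
    also have "\<dots> \<le> (card U + 1) ^ \<alpha>" using True by (intro power_increasing) auto
    finally have "real (card (L C)) \<le> real ((card U + 1) ^ \<alpha>)" by (rule of_nat_mono)
    then show ?thesis using True by (simp add: L_def l_def max_def)
  next
    case False
    define B where "B = real (card U + 1) ^ \<alpha>"
    have B: "0 \<le> B" by (simp add: B_def)
    have nl: "d * real l \<le> real n" using dense_support[OF less.prems(3)] by (simp add: l_def n_def)
    have bd: "real (card (L {c \<in> C. j \<notin> c})) \<le> real ((l - 1) choose \<alpha>) * B" if "j \<in> \<Union>C" for j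
    proof -
      let ?D = "{c \<in> C. j \<notin> c}"
      have lt: "cl ?D < cl C" by (rule cl_avoid_less[OF less.prems(1) that])
      have "real (card (L ?D)) \<le> real ((max \<alpha> (cl ?D)) choose \<alpha>) * B"
        unfolding L_def B_def using less.prems lt by (intro less.hyps dense_avoid) auto
      also have "\<dots> \<le> real ((l - 1) choose \<alpha>) * B"
        using lt False B by (intro mult_right_mono of_nat_mono binomial_right_mono) (auto simp: l_def)
      finally show ?thesis .
    qed
    \<comment> \<open>Double counting of the pairs of a light word \<open>c\<close> and a support
      point \<open>j\<close> outside \<open>c\<close>: each light word misses at least
      \<open>n - \<alpha> * d\<close> points, and \<open>bd\<close> bounds the light words for each
      \<open>j\<close>.\<close>
    have "real (card (L C)) * (real n - real \<alpha> * d)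
            = (\<Sum>c\<in>L C. real n - real \<alpha> * d)" by simp
    also have "\<dots> \<le> (\<Sum>c\<in>L C. real (card (\<Union>C - c)))"
    proof (rule sum_mono)
      fix c assume c: "c \<in> L C"
      then have sub: "c \<subseteq> \<Union>C" by (auto simp: L_def)
      have "card (\<Union>C - c) = n - card c" "card c \<le> n"
        unfolding n_def
        using card_Diff_subset[OF finite_subset[OF sub finU] sub] card_mono[OF finU sub] by auto
      then show "real n - real \<alpha> * d \<le> real (card (\<Union>C - c))" using c by (simp add: L_def)
    qed
    also have "\<dots> = (\<Sum>c\<in>L C. \<Sum>j\<in>\<Union>C. if j \<notin> c then 1 else 0)"
    proof (rule sum.cong[OF refl])
      fix c
      have "\<Union>C \<inter> {j. j \<notin> c} = \<Union>C - c" by blast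
      then show "real (card (\<Union>C - c)) = (\<Sum>j\<in>\<Union>C. if j \<notin> c then 1 else 0)"
        using finU by (simp add: sum.If_cases del: Union_iff)
    qed
    also have "\<dots> = (\<Sum>j\<in>\<Union>C. \<Sum>c\<in>L C. if j \<notin> c then 1 else 0)" by (rule sum.swap)
    also have "\<dots> = (\<Sum>j\<in>\<Union>C. real (card (L {c \<in> C. j \<notin> c})))"
    proof (rule sum.cong[OF refl])
      fix j
      have "L C \<inter> {c. j \<notin> c} = L {c \<in> C. j \<notin> c}" by (auto simp: L_def)
      then show "(\<Sum>c\<in>L C. if j \<notin> c then 1 else (0::real)) = real (card (L {c \<in> C. j \<notin> c}))"
        using less.prems(1) by (simp add: sum.If_cases L_def)
    qed
    also have "\<dots> \<le> real n * (real ((l - 1) choose \<alpha>) * B)"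
      unfolding n_def by (rule sum_bounded_above) (rule bd)
    finally have A: "real (card (L C)) * (real n - real \<alpha> * d)
        \<le> real n * (real ((l - 1) choose \<alpha>) * B)" .
    \<comment> \<open>The factor l / (l - \<alpha>) lost in one contraction is exactly the ratio of
      the two successive binomials.\<close>
    have absorb: "(real l - real \<alpha>) * real (l choose \<alpha>) = real l * real ((l - 1) choose \<alpha>)"
      using arg_cong[OF binomial_absorb_comp[of l \<alpha>], of real] False by (simp add: of_nat_diff)
    have lpos: "0 < real l - real \<alpha>" using False by simp
    have npos: "0 < real n - real \<alpha> * d"
    proof -
      have "real \<alpha> * d < d * real l" using False assms(5) by simp
      then show ?thesis using nl by simp
    qed
    \<comment> \<open>Density gives \<open>n \<ge> d * l\<close>, so the missed fraction (n -
      \<alpha> d) / n is at least (l - \<alpha>) / l.\<close>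
    have ineq: "real n * (real l - real \<alpha>) \<le> (real n - real \<alpha> * d) * real l"
    proof -
      have "real \<alpha> * (d * real l) \<le> real \<alpha> * real n" using nl by (intro mult_left_mono) auto
      then show ?thesis by (simp add: algebra_simps)
    qed
    have "real n * real ((l - 1) choose \<alpha>) * (real l - real \<alpha>)
        \<le> (real n - real \<alpha> * d) * (real l * real ((l - 1) choose \<alpha>))"
      using mult_right_mono[OF ineq of_nat_0_le_iff[of "(l - 1) choose \<alpha>"]]
      by (simp only: mult.assoc mult.commute mult.left_commute)
    also have "\<dots> = (real n - real \<alpha> * d) * real (l choose \<alpha>) * (real l - real \<alpha>)"
      by (simp only: absorb[symmetric] ac_simps)
    finally have "real n * real ((l - 1) choose \<alpha>) \<le> (real n - real \<alpha> * d) * real (l choose \<alpha>)"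
      using lpos by simp
    then have "real n * (real ((l - 1) choose \<alpha>) * B) \<le> (real n - real \<alpha> * d) * real (l choose \<alpha>) * B"
      using mult_right_mono[OF _ B] by (simp only: mult.assoc[symmetric])
    with A have "real (card (L C)) * (real n - real \<alpha> * d)
        \<le> (real (l choose \<alpha>) * B) * (real n - real \<alpha> * d)"
      by (simp only: ac_simps)
    then have "real (card (L C)) \<le> real (l choose \<alpha>) * B"
      using npos by simp
    then show ?thesis using False by (simp add: L_def B_def l_def max_def)
  qed
qed

text \<open>As \<open>d\<close> is at least 1, density forces \<open>cl C\<close> to be at most
  \<open>card U\<close>, so the binomial costs only a second factor
  \<open>(card U + 1) ^ \<alpha>\<close>.\<close>

lemma card_light_words:
  assumes "finite C" "\<Union>C \<subseteq> U" "finite U" "dense d C" "1 \<le> d"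
  shows "real (card {c \<in> C. real (card c) \<le> real \<alpha> * d}) \<le> real (card U + 1) ^ (2 * \<alpha>)"
proof -
  have "1 * real (cl C) \<le> d * real (cl C)" using assms(5) by (intro mult_right_mono) auto
  also have "\<dots> \<le> real (card (\<Union>C))" by (rule dense_support[OF assms(4)])
  also have "\<dots> \<le> real (card U)" using assms by (simp add: card_mono)
  finally have "cl C \<le> card U + 1" by simp
  then have "(max \<alpha> (cl C)) choose \<alpha> \<le> (card U + 1) ^ \<alpha>"
  proof (cases "cl C \<le> \<alpha>")
    case False
    then have "cl C choose \<alpha> \<le> cl C ^ \<alpha>" by (intro binomial_le_pow) simp
    also have "\<dots> \<le> (card U + 1) ^ \<alpha>" using \<open>cl C \<le> _\<close> by (intro power_mono) auto
    finally show ?thesis using False by (simp add: max_def)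
  qed (simp add: max_def)
  then have "real ((max \<alpha> (cl C)) choose \<alpha>) \<le> real (card U + 1) ^ \<alpha>"
    by (metis of_nat_le_iff of_nat_power)
  then have "real ((max \<alpha> (cl C)) choose \<alpha>) * real (card U + 1) ^ \<alpha>
      \<le> real (card U + 1) ^ \<alpha> * real (card U + 1) ^ \<alpha>"
    by (intro mult_right_mono) auto
  also have "\<dots> = real (card U + 1) ^ (2 * \<alpha>)" by (simp add: mult_2 flip: power_add)
  finally show ?thesis
    using card_light_words_binomial[OF assms(1-4), of \<alpha>] assms(5) by linarith
qed

section \<open>Exponential moments of a random subset, and sampling\<close>

text \<open>For negative \<open>t\<close>, multiply by \<open>exp (- t) \<ge> 1 - t\<close> and use
  (1 + t + t^2) (1 - t) = 1 - t^3 \<ge> 1.\<close>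

lemma exp_quadratic_bound:
  fixes t :: real
  assumes "\<bar>t\<bar> \<le> 1"
  shows "exp t \<le> 1 + t + t\<^sup>2"
proof (cases "0 \<le> t")
  case True
  then show ?thesis using exp_bound[of t] assms by simp
next
  case False
  then have "1 - t \<le> exp (- t)" using exp_ge_add_one_self[of "- t"] by simp
  moreover have "1 \<le> (1 + t + t\<^sup>2) * (1 - t)"
  proof -
    have "(1 + t + t\<^sup>2) * (1 - t) = 1 - t ^ 3" by (simp add: algebra_simps power2_eq_square power3_eq_cube)
    moreover have "t ^ 3 \<le> 0" using False by (simp add: power_le_zero_eq)
    ultimately show ?thesis by simp
  qed
  moreover have "0 \<le> 1 + t + t\<^sup>2"
  proof -
    have "0 \<le> (t + 1/2)\<^sup>2" by simp
    then show ?thesis by (simp add: power2_eq_square algebra_simps)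
  qed
  ultimately have "1 \<le> (1 + t + t\<^sup>2) * exp (- t)"
    by (meson mult_left_mono order_trans)
  then show ?thesis by (simp add: exp_minus field_simps)
qed

text \<open>The probability of the outcome \<open>R\<close> when every point of \<open>A\<close> is
  kept independently with probability \<open>p\<close>; expectations are finite sums over
  \<open>Pow A\<close>.\<close>

definition bern :: "real \<Rightarrow> 'a set \<Rightarrow> 'a set \<Rightarrow> real" where
  "bern p A R = p ^ card R * (1 - p) ^ card (A - R)"

lemma sum_bern: "finite A \<Longrightarrow> (\<Sum>R\<in>Pow A. bern p A R) = 1"
  using prod_add[of A "\<lambda>_. p" "\<lambda>_. 1 - p"] by (simp add: bern_def)

lemma bern_nonneg: "0 \<le> p \<Longrightarrow> p \<le> 1 \<Longrightarrow> 0 \<le> bern p A R"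
  by (simp add: bern_def)

text \<open>The moment generating function of a binomial variable: the sum factors over the points
  of \<open>A\<close> (\<open>prod_add\<close>), points outside \<open>c\<close> contribute 1, and
  each point of \<open>c\<close> contributes \<open>1 + p * (exp t - 1)\<close>, at most
  \<open>exp (p * (t + t\<^sup>2))\<close>.\<close>

lemma sum_bern_exp_le:
  assumes "finite A" "c \<subseteq> A" "0 \<le> p" "p \<le> 1" "\<bar>t\<bar> \<le> 1"
  shows "(\<Sum>R\<in>Pow A. bern p A R * exp (t * real (card (R \<inter> c))))
           \<le> exp (p * real (card c) * (t + t\<^sup>2))"
proof -
  have "(\<Sum>R\<in>Pow A. bern p A R * exp (t * real (card (R \<inter> c))))
      = (\<Sum>R\<in>Pow A. (\<Prod>x\<in>R. p * (if x \<in> c then exp t else 1)) * (\<Prod>x\<in>A-R. 1 - p))"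
  proof (rule sum.cong[OF refl])
    fix R assume "R \<in> Pow A"
    then have "finite R" using assms(1) by (auto dest: finite_subset)
    moreover have "exp (t * real (card (R \<inter> c))) = exp t ^ card (R \<inter> c)"
      by (rule exp_of_nat2_mult)
    ultimately show "bern p A R * exp (t * real (card (R \<inter> c)))
        = (\<Prod>x\<in>R. p * (if x \<in> c then exp t else 1)) * (\<Prod>x\<in>A-R. 1 - p)"
      by (simp add: bern_def prod.distrib prod.If_cases)
  qed
  also have "\<dots> = (\<Prod>x\<in>A. p * (if x \<in> c then exp t else 1) + (1 - p))"
    using assms(1) by (rule prod_add[symmetric])
  also have "\<dots> = (\<Prod>x\<in>A. if x \<in> c then 1 + p * (exp t - 1) else 1)"
    by (rule prod.cong) (auto simp: algebra_simps)
  also have "\<dots> = (1 + p * (exp t - 1)) ^ card c"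
    using assms(1,2) by (simp add: prod.If_cases Int_absorb1)
  also have "\<dots> \<le> exp (p * (t + t\<^sup>2)) ^ card c"
  proof (rule power_mono)
    have "1 + p * (exp t - 1) \<le> 1 + p * (t + t\<^sup>2)"
      using exp_quadratic_bound[OF assms(5)] assms(3) by (intro add_left_mono mult_left_mono) auto
    also have "\<dots> \<le> exp (p * (t + t\<^sup>2))" by (rule exp_ge_add_one_self)
    finally show "1 + p * (exp t - 1) \<le> exp (p * (t + t\<^sup>2))" .
    have "0 \<le> (1 - p) + p * exp t" using assms by (intro add_nonneg_nonneg mult_nonneg_nonneg) auto
    then show "0 \<le> 1 + p * (exp t - 1)" by (simp add: algebra_simps)
  qed
  also have "\<dots> = exp (p * real (card c) * (t + t\<^sup>2))"
    by (subst exp_of_nat_mult[symmetric]) (simp add: mult_ac)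
  finally show ?thesis .
qed

text \<open>The union bound for \<open>sampling\<close>. Words are grouped by weight in units of
  \<open>d\<close>: class \<open>j\<close> has at most \<open>q ^ (4 * j)\<close> words by
  \<open>card_light_words\<close>, while the rate makes each term at most
  \<open>2 * (1 / q) ^ (8 * j)\<close>. The \<open>m\<close> classes then sum to at most 2 /
  q^3.\<close>

lemma sum_exp_words_le:
  fixes d p \<delta> :: real and m :: nat
  assumes "finite A" "\<Union>D \<subseteq> A" "dense d D" "1 \<le> d" "0 < p" "card A \<le> m" "1 \<le> m"
    and rate: "32 * ln (real m + 1) \<le> p * d * \<delta>\<^sup>2"
  shows "(\<Sum>c\<in>D - {{}}. 2 * exp (- (p * real (card c) * \<delta>\<^sup>2 / 4))) \<le> 1 / 4"
proof -
  define q where "q = real m + 1"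
  have q: "2 \<le> q" using assms(7) by (simp add: q_def)
  \<comment> \<open>By \<open>dense_word\<close>, nonempty words have \<open>a c \<ge> 1\<close>. So
    there is no class 0, and \<open>2 * (j + 1) \<le> 4 * j\<close> holds for every class.\<close>
  define a where "a c = nat \<lfloor>real (card c) / d\<rfloor>" for c :: "'a set"
  have finD: "finite D"
    using assms(1,2) by (auto intro: finite_subset[of _ "Pow A"])
  have a: "1 \<le> a c \<and> a c \<le> m \<and> real (a c) * d \<le> real (card c) \<and> real (card c) \<le> real (a c + 1) * d"
    if c: "c \<in> D - {{}}" for c
  proof -
    have sub: "c \<subseteq> A" using c assms(2) by auto
    have "d \<le> real (card c)"
      using dense_word[OF assms(3) finD, of c] c assms(4) by auto
    then have ge1: "1 \<le> real (card c) / d" using assms(4) by (simp add: field_simps)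
    have "real (card c) / d \<le> real (card c) / 1"
      using assms(4) by (intro divide_left_mono) auto
    also have "\<dots> \<le> real m" using card_mono[OF assms(1) sub] assms(6) by simp
    finally have lem: "real (card c) / d \<le> real m" .
    have fl: "real (a c) \<le> real (card c) / d" "real (card c) / d \<le> real (a c + 1)"
      using ge1 unfolding a_def by linarith+
    have "1 \<le> a c" using ge1 unfolding a_def by linarith
    moreover have "a c \<le> m" using fl(1) lem by linarith
    ultimately show ?thesis using fl assms(4) by (simp add: field_simps)
  qed
  have bound: "(\<Sum>c | c \<in> D - {{}} \<and> a c = j. 2 * exp (- (p * real (card c) * \<delta>\<^sup>2 / 4))) \<le> 2 * (1 / q) ^ 4"
    if j: "j \<in> {1..m}" for j
  proof -
    let ?W = "{c. c \<in> D - {{}} \<and> a c = j}"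
    have "(\<Sum>c\<in>?W. 2 * exp (- (p * real (card c) * \<delta>\<^sup>2 / 4))) \<le> real (card ?W) * (2 * (1 / q) ^ (8 * j))"
    proof (rule sum_bounded_above)
      fix c assume c: "c \<in> ?W"
      \<comment> \<open>The constant 32 in the rate is 4 * 8: after the division by 4 in the
        exponent, 8 powers of \<open>q\<close> per unit of \<open>j\<close> remain.\<close>
      have "real j * (32 * ln q) \<le> real j * (p * d * \<delta>\<^sup>2)"
        using rate by (intro mult_left_mono) (auto simp: q_def)
      also have "\<dots> = p * \<delta>\<^sup>2 * (real j * d)" by simp
      also have "\<dots> \<le> p * \<delta>\<^sup>2 * real (card c)"
        using a[of c] c assms(5) by (intro mult_left_mono) auto
      finally have "- (p * real (card c) * \<delta>\<^sup>2 / 4) \<le> real (8 * j) * (- ln q)"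
        by (simp add: mult_ac)
      then have "exp (- (p * real (card c) * \<delta>\<^sup>2 / 4)) \<le> exp (real (8 * j) * (- ln q))"
        by simp
      also have "\<dots> = (1 / q) ^ (8 * j)"
        using q by (subst exp_of_nat_mult) (simp add: exp_minus inverse_eq_divide)
      finally show "2 * exp (- (p * real (card c) * \<delta>\<^sup>2 / 4)) \<le> 2 * (1 / q) ^ (8 * j)" by simp
    qed
    also have "\<dots> \<le> q ^ (4 * j) * (2 * (1 / q) ^ (8 * j))"
    proof (rule mult_right_mono)
      have "real (card ?W) \<le> real (card {c \<in> D. real (card c) \<le> real (j + 1) * d})"
        using a finD by (intro of_nat_mono card_mono) auto
      also have "\<dots> \<le> real (card A + 1) ^ (2 * (j + 1))"
        by (rule card_light_words[OF finD assms(2,1,3,4)])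
      also have "\<dots> \<le> q ^ (2 * (j + 1))"
        using assms(6) by (intro power_mono) (auto simp: q_def)
      also have "\<dots> \<le> q ^ (4 * j)"
        using q j by (intro power_increasing) auto
      finally show "real (card ?W) \<le> q ^ (4 * j)" .
    qed (use q in simp)
    also have "\<dots> = 2 * (1 / q) ^ (4 * j)"
    proof -
      have "8 * j = 4 * j + 4 * j" by simp
      then have "q ^ (4 * j) * (1 / q) ^ (8 * j) = (1 / q) ^ (4 * j)"
        using q by (simp only: power_add) (simp add: power_divide)
      then show ?thesis by (simp only: mult.left_commute)
    qed
    also have "\<dots> \<le> 2 * (1 / q) ^ 4"
      using q j by (intro mult_left_mono power_decreasing) auto
    finally show ?thesis .
  qed
  have "a ` (D - {{}}) \<subseteq> {1..m}"
  proof (rule image_subsetI)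
    fix c assume "c \<in> D - {{}}"
    then show "a c \<in> {1..m}" using a[of c] by simp
  qed
  then have "(\<Sum>c\<in>D - {{}}. 2 * exp (- (p * real (card c) * \<delta>\<^sup>2 / 4)))
      = (\<Sum>j\<in>{1..m}. \<Sum>c | c \<in> D - {{}} \<and> a c = j. 2 * exp (- (p * real (card c) * \<delta>\<^sup>2 / 4)))"
    using finD by (intro sum.group[symmetric]) auto
  also have "\<dots> \<le> real (card {1..m}) * (2 * (1 / q) ^ 4)"
    by (rule sum_bounded_above) (rule bound)
  also have "\<dots> \<le> q * (2 * (1 / q) ^ 4)"
    using q by (intro mult_right_mono) (auto simp: q_def)
  also have "\<dots> = 2 * (1 / q) ^ 3"
    using q by (simp add: field_simps power_numeral_reduce)
  also have "\<dots> \<le> 2 * (1 / 2) ^ 3"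
    using q by (intro mult_left_mono power_mono) (auto simp: field_simps)
  finally show ?thesis by (simp add: power_numeral_reduce)
qed

text \<open>Prepares Markov's inequality: in the uses \<open>s\<close> is \<open>t\<close> times a
  threshold, so the exponential is at least 1 on every outcome that violates the threshold.\<close>

lemma sum_bern_exp_shift_le:
  assumes "finite A" "c \<subseteq> A" "0 \<le> p" "p \<le> 1" "\<bar>t\<bar> \<le> 1"
  shows "(\<Sum>R\<in>Pow A. bern p A R * exp (t * real (card (R \<inter> c)) - s))
           \<le> exp (p * real (card c) * (t + t\<^sup>2) - s)"
proof -
  have "(\<Sum>R\<in>Pow A. bern p A R * exp (t * real (card (R \<inter> c)) - s))
      = (\<Sum>R\<in>Pow A. bern p A R * exp (t * real (card (R \<inter> c)))) * exp (- s)"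
    unfolding sum_distrib_right by (simp add: exp_diff exp_minus divide_inverse mult.assoc)
  also have "\<dots> \<le> exp (p * real (card c) * (t + t\<^sup>2)) * exp (- s)"
    using sum_bern_exp_le[OF assms] by (intro mult_right_mono) auto
  finally show ?thesis by (simp add: exp_diff exp_minus divide_inverse)
qed

text \<open>The expectation of the potential \<open>f\<close> is below 1, so some \<open>R\<close> has \<open>f R < 1\<close>; then every
  exponent in \<open>f\<close> is negative, and these are the required inequalities.\<close>

lemma sampling:
  fixes d p \<delta> M :: real and m :: nat
  assumes "finite A" "\<Union>D \<subseteq> A" "dense d D" "1 \<le> d" "0 < p" "p \<le> 1" "card A \<le> m" "1 \<le> m"
    and \<delta>: "0 < \<delta>" "\<delta> < 1" and rate: "32 * ln (real m + 1) \<le> p * d * \<delta>\<^sup>2"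
    and M: "8 \<le> M" "p * real (card A) \<le> M / 2"
  obtains R where "R \<subseteq> A" "real (card R) \<le> M"
    "\<And>c. c \<in> D \<Longrightarrow> (1 - \<delta>) * (p * real (card c)) \<le> real (card (R \<inter> c))"
    "\<And>c. c \<in> D \<Longrightarrow> real (card (R \<inter> c)) \<le> (1 + \<delta>) * (p * real (card c))"
proof -
  \<comment> \<open>This \<open>t\<close> minimises \<open>t\<^sup>2 - \<delta> * t\<close>, the
    factor of \<open>p * card c\<close> in both tail exponents; the minimum is - \<delta>^2 /
    4.\<close>
  define t where "t = \<delta> / 2"
  have finD: "finite D"
    using assms(1,2) by (auto intro: finite_subset[of _ "Pow A"])
  define g h where
    "g R c = exp (t * real (card (R \<inter> c)) - t * ((1 + \<delta>) * (p * real (card c))))" and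
    "h R c = exp (- t * real (card (R \<inter> c)) - - t * ((1 - \<delta>) * (p * real (card c))))" for R c :: "'a set"
  define f where "f R = exp (1 / 2 * real (card (R \<inter> A)) - M / 2) + (\<Sum>c\<in>D - {{}}. g R c + h R c)" for R
  have "(\<Sum>R\<in>Pow A. bern p A R * f R)
      = (\<Sum>R\<in>Pow A. bern p A R * exp (1 / 2 * real (card (R \<inter> A)) - M / 2))
        + (\<Sum>R\<in>Pow A. \<Sum>c\<in>D - {{}}. bern p A R * g R c + bern p A R * h R c)"
    unfolding f_def sum.distrib[symmetric] by (simp only: distrib_left sum_distrib_left)
  also have "(\<Sum>R\<in>Pow A. \<Sum>c\<in>D - {{}}. bern p A R * g R c + bern p A R * h R c)
      = (\<Sum>c\<in>D - {{}}. \<Sum>R\<in>Pow A. bern p A R * g R c + bern p A R * h R c)"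
    by (rule sum.swap)
  also have "\<dots> = (\<Sum>c\<in>D - {{}}. (\<Sum>R\<in>Pow A. bern p A R * g R c) + (\<Sum>R\<in>Pow A. bern p A R * h R c))"
    by (simp only: sum.distrib)
  also have "(\<Sum>R\<in>Pow A. bern p A R * exp (1 / 2 * real (card (R \<inter> A)) - M / 2)) + \<dots>
      \<le> exp (- 1) + 1 / 4"
  proof (rule add_mono)
    have "(\<Sum>R\<in>Pow A. bern p A R * exp (1 / 2 * real (card (R \<inter> A)) - M / 2))
        \<le> exp (p * real (card A) * (1 / 2 + (1 / 2)\<^sup>2) - M / 2)"
      using assms by (intro sum_bern_exp_shift_le) auto
    also have "\<dots> \<le> exp (- 1)"
    \<comment> \<open>The exponent is at most (3/4) (M/2) - M/2 = - M/8, and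
      \<open>M \<ge> 8\<close>.\<close>
    proof -
      have "p * real (card A) * (1 / 2 + (1 / 2)\<^sup>2) \<le> M / 2 * (1 / 2 + (1 / 2)\<^sup>2)"
        by (rule mult_right_mono[OF M(2)]) simp
      then show ?thesis using M(1) by (simp add: power2_eq_square)
    qed
    finally show "(\<Sum>R\<in>Pow A. bern p A R * exp (1 / 2 * real (card (R \<inter> A)) - M / 2)) \<le> exp (- 1)" .
    have "(\<Sum>c\<in>D - {{}}. (\<Sum>R\<in>Pow A. bern p A R * g R c) + (\<Sum>R\<in>Pow A. bern p A R * h R c))
        \<le> (\<Sum>c\<in>D - {{}}. 2 * exp (- (p * real (card c) * \<delta>\<^sup>2 / 4)))"
    proof (rule sum_mono)
      fix c assume c: "c \<in> D - {{}}"
      then have sub: "c \<subseteq> A" using assms(2) by auto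
      have "(\<Sum>R\<in>Pow A. bern p A R * g R c)
          \<le> exp (p * real (card c) * (t + t\<^sup>2) - t * ((1 + \<delta>) * (p * real (card c))))"
        unfolding g_def using assms sub by (intro sum_bern_exp_shift_le) (auto simp: t_def)
      also have "p * real (card c) * (t + t\<^sup>2) - t * ((1 + \<delta>) * (p * real (card c)))
          = - (p * real (card c) * \<delta>\<^sup>2 / 4)"
        unfolding t_def by (simp add: power2_eq_square algebra_simps)
      finally have 1: "(\<Sum>R\<in>Pow A. bern p A R * g R c) \<le> exp (- (p * real (card c) * \<delta>\<^sup>2 / 4))" .
      have "(\<Sum>R\<in>Pow A. bern p A R * h R c)
          \<le> exp (p * real (card c) * (- t + (- t)\<^sup>2) - - t * ((1 - \<delta>) * (p * real (card c))))"
        unfolding h_def using assms sub by (intro sum_bern_exp_shift_le) (auto simp: t_def)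
      also have "p * real (card c) * (- t + (- t)\<^sup>2) - - t * ((1 - \<delta>) * (p * real (card c)))
          = - (p * real (card c) * \<delta>\<^sup>2 / 4)"
        unfolding t_def by (simp add: power2_eq_square algebra_simps)
      finally have 2: "(\<Sum>R\<in>Pow A. bern p A R * h R c) \<le> exp (- (p * real (card c) * \<delta>\<^sup>2 / 4))" .
      show "(\<Sum>R\<in>Pow A. bern p A R * g R c) + (\<Sum>R\<in>Pow A. bern p A R * h R c)
          \<le> 2 * exp (- (p * real (card c) * \<delta>\<^sup>2 / 4))"
        using 1 2 by simp
    qed
    also have "\<dots> \<le> 1 / 4"
      using assms(1-5,7,8) rate by (rule sum_exp_words_le)
    finally show "(\<Sum>c\<in>D - {{}}. (\<Sum>R\<in>Pow A. bern p A R * g R c) + (\<Sum>R\<in>Pow A. bern p A R * h R c))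
        \<le> 1 / 4" .
  qed
  also have "\<dots> < 1"
  proof -
    have "2 \<le> exp (1::real)" using exp_ge_add_one_self[of "1::real"] by simp
    then show ?thesis by (simp add: exp_minus field_simps)
  qed
  finally have "(\<Sum>R\<in>Pow A. bern p A R * f R) < 1" .
  moreover have "1 \<le> (\<Sum>R\<in>Pow A. bern p A R * f R)" if "\<And>R. R \<in> Pow A \<Longrightarrow> 1 \<le> f R"
  proof -
    have "(\<Sum>R\<in>Pow A. bern p A R * 1) \<le> (\<Sum>R\<in>Pow A. bern p A R * f R)"
      using that assms by (intro sum_mono mult_left_mono bern_nonneg) auto
    then show ?thesis using sum_bern[OF assms(1), of p] by simp
  qed
  ultimately obtain R where "R \<in> Pow A" "f R < 1" by (meson not_le)
  then have R: "R \<subseteq> A" "f R < 1" by auto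
  have pos: "0 < g R c" "0 < h R c" for c by (simp_all add: g_def h_def)
  have nn: "0 \<le> g R c + h R c" for c using pos[of c] by linarith
  have tp: "0 < t" using \<delta> by (simp add: t_def)
  have word: "(1 - \<delta>) * (p * real (card c)) \<le> real (card (R \<inter> c)) \<and>
      real (card (R \<inter> c)) \<le> (1 + \<delta>) * (p * real (card c))" if c: "c \<in> D" for c
  proof (cases "c = {}")
    case False
    have "g R c + h R c \<le> (\<Sum>c\<in>D - {{}}. g R c + h R c)"
      using c False finD nn by (intro member_le_sum) auto
    also have "\<dots> < 1"
      using R(2) exp_gt_zero[of "1 / 2 * real (card (R \<inter> A)) - M / 2"] unfolding f_def by linarith
    finally have "g R c < 1" "h R c < 1"
      using pos[of c] by linarith+
    then have "t * real (card (R \<inter> c)) < t * ((1 + \<delta>) * (p * real (card c)))"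
      "t * ((1 - \<delta>) * (p * real (card c))) < t * real (card (R \<inter> c))"
      unfolding g_def h_def by simp_all
    then show ?thesis using tp by simp
  qed simp
  have "0 \<le> (\<Sum>c\<in>D - {{}}. g R c + h R c)" by (rule sum_nonneg) (rule nn)
  then have "exp (1 / 2 * real (card (R \<inter> A)) - M / 2) < 1"
    using R(2) unfolding f_def by linarith
  then have "real (card (R \<inter> A)) \<le> M" by simp
  then have "real (card R) \<le> M" using R(1) by (simp only: Int_absorb2)
  then show ?thesis using that[of R] R(1) word by simp
qed

section \<open>Iterated splitting and sampling\<close>

text \<open>One level replaces the ratio of \<open>card S\<close> to \<open>4 * cl C * B\<close> by its square root, both for the
  removed set \<open>T\<close> and for the sample \<open>R\<close>; the sampling rate is chosen to balance the two.\<close>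

lemma sparsify_iterated:
  fixes \<delta> B :: real and m k :: nat
  assumes "finite X" "\<Union>C \<subseteq> X" "card X \<le> m" "1 \<le> m" "1 \<le> cl C"
    and \<delta>: "0 < \<delta>" "\<delta> < 1" and B: "2 \<le> B" "32 * ln (real m + 1) \<le> B * \<delta>\<^sup>2"
    and S: "S \<subseteq> X" "real (card S) \<le> 4 * real (cl C) * B * 2 ^ 2 ^ k"
  shows "\<exists>w. (\<forall>i. 0 \<le> w i) \<and> {i. w i \<noteq> 0} \<subseteq> S \<and>
    real (card {i. w i \<noteq> 0}) \<le> 2 ^ k * (8 * real (cl C) * B) \<and>
    (\<forall>c\<in>C. (1 - \<delta>) ^ k * real (card (S \<inter> c)) \<le> sum w c \<and>
            sum w c \<le> (1 + \<delta>) ^ k * real (card (S \<inter> c)))"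
  using S
proof (induction k arbitrary: S)
  case 0
  \<comment> \<open>At level 0 the size hypothesis reads \<open>card S \<le> 8 * cl C * B\<close>,
    so \<open>S\<close> itself is kept with unit weights.\<close>
  let ?w = "\<lambda>i. if i \<in> S then 1 else 0 :: real"
  have "sum ?w c = real (card (S \<inter> c))" if "c \<in> C" for c
  proof -
    have "finite c" using that assms(1,2) by (auto intro: finite_subset)
    then show ?thesis by (simp add: sum.If_cases Int_commute)
  qed
  moreover have "{i. ?w i \<noteq> 0} = S" by auto
  ultimately show ?case using 0 by (intro exI[of _ ?w]) simp
next
  case (Suc k)
  define l where "l = real (cl C)"
  define Y :: real where "Y = 2 ^ 2 ^ k"
  \<comment> \<open>\<open>Y\<close> is the square root of the present bound on the ratio
    (\<open>YY\<close>). \<open>d\<close> keeps the removed set within \<open>d * l = M / 2\<close>,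
    \<open>p\<close> keeps the expected sample within \<open>M / 2\<close>, \<open>p * d = B\<close>
    gives the rate that \<open>sampling\<close> asks for, and \<open>M\<close> is the size
    hypothesis of the next level.\<close>
  define p d M where "p = 1 / (2 * Y)" and "d = 2 * B * Y" and "M = 4 * l * B * Y"
  have Y: "1 \<le> Y" by (simp add: Y_def)
  have l: "1 \<le> l" using assms(5) by (simp add: l_def)
  have BY: "2 * 1 \<le> B * Y" using B(1) Y by (intro mult_mono) auto
  have lBY: "1 * 2 \<le> l * (B * Y)" using l BY by (intro mult_mono) auto
  have p: "0 < p" "p \<le> 1" using Y by (auto simp: p_def field_simps)
  have YY: "(2::real) ^ 2 ^ Suc k = Y * Y" by (simp add: Y_def power_add mult_2)
  have finS: "finite S" using Suc.prems(1) assms(1) finite_subset by auto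
  have finC: "finite C"
    using assms(1,2) by (auto intro: finite_subset[of _ "Pow X"])
  \<comment> \<open>Intersection with \<open>S\<close> is written as a set difference so that
    \<open>cl_image_Diff_le\<close> applies.\<close>
  define D0 where "D0 = (\<lambda>c. c - (- S)) ` C"
  have finD0: "finite D0" using finC by (simp add: D0_def)
  have subD0: "\<Union>D0 \<subseteq> S" by (auto simp: D0_def)
  have "d * real (cl D0) \<le> d * l"
    unfolding D0_def l_def using BY
    by (intro mult_left_mono of_nat_mono cl_image_Diff_le finC) (simp add: d_def)
  moreover obtain T where T: "T \<subseteq> \<Union>D0" "real (card T) \<le> d * real (cl D0)" "dense d ((\<lambda>c. c - T) ` D0)"
  proof (rule dense_decomposition[OF finD0, of d])
    show "finite c" if "c \<in> D0" for c using that subD0 finS by (auto intro: finite_subset)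
    show "0 \<le> d" using BY by (simp add: d_def)
  qed
  ultimately have cT: "real (card T) \<le> M" using lBY by (simp add: d_def M_def mult_ac)
  have TS: "T \<subseteq> S" using T(1) subD0 by auto
  define A where "A = S - T"
  define D where "D = (\<lambda>c. c - T) ` D0"
  have D_eq: "D = (\<lambda>c. c \<inter> A) ` C"
    unfolding D_def D0_def image_image by (rule image_cong) (auto simp: A_def)
  have AX: "A \<subseteq> X" using Suc.prems(1) by (auto simp: A_def)
  have finA: "finite A" using AX assms(1) finite_subset by auto
  have cA: "p * real (card A) \<le> M / 2"
  proof -
    have "p * real (card A) \<le> p * real (card S)"
      using p finS by (intro mult_left_mono of_nat_mono card_mono) (auto simp: A_def)
    also have "\<dots> \<le> p * (4 * l * B * (Y * Y))"
      using Suc.prems(2) p unfolding YY l_def by (intro mult_left_mono) auto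
    also have "\<dots> = M / 2" using Y by (simp add: p_def M_def field_simps)
    finally show ?thesis .
  qed
  have pd: "p * d = B" using Y by (simp add: p_def d_def)
  obtain R where R: "R \<subseteq> A" "real (card R) \<le> M"
    "\<And>c. c \<in> D \<Longrightarrow> (1 - \<delta>) * (p * real (card c)) \<le> real (card (R \<inter> c))"
    "\<And>c. c \<in> D \<Longrightarrow> real (card (R \<inter> c)) \<le> (1 + \<delta>) * (p * real (card c))"
  proof (rule sampling[of A D d p m \<delta> M])
    show "\<Union>D \<subseteq> A" by (auto simp: D_eq)
    show "dense d D" using T(3) by (simp add: D_def)
    show "1 \<le> d" using BY by (simp add: d_def)
    show "card A \<le> m" using card_mono[OF assms(1) AX] assms(3) by simp
    show "8 \<le> M" using lBY unfolding M_def mult.assoc by linarith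
    show "32 * ln (real m + 1) \<le> p * d * \<delta>\<^sup>2" using B(2) by (simp add: pd)
  qed (use finA p cA \<delta> assms(4) in auto)
  \<comment> \<open>The induction hypothesis is used on the removed set and on the sample, which
    doubles the support bound at each level.\<close>
  obtain w1 where w1: "\<forall>i. 0 \<le> w1 i" "{i. w1 i \<noteq> 0} \<subseteq> T"
    "real (card {i. w1 i \<noteq> 0}) \<le> 2 ^ k * (8 * l * B)"
    "\<forall>c\<in>C. (1 - \<delta>) ^ k * real (card (T \<inter> c)) \<le> sum w1 c \<and>
            sum w1 c \<le> (1 + \<delta>) ^ k * real (card (T \<inter> c))"
    using Suc.IH[of T] TS Suc.prems(1) cT unfolding M_def l_def Y_def by blast
  obtain w2 where w2: "\<forall>i. 0 \<le> w2 i" "{i. w2 i \<noteq> 0} \<subseteq> R"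
    "real (card {i. w2 i \<noteq> 0}) \<le> 2 ^ k * (8 * l * B)"
    "\<forall>c\<in>C. (1 - \<delta>) ^ k * real (card (R \<inter> c)) \<le> sum w2 c \<and>
            sum w2 c \<le> (1 + \<delta>) ^ k * real (card (R \<inter> c))"
    using Suc.IH[of R] R(1,2) AX unfolding M_def l_def Y_def by blast
  \<comment> \<open>The sample is rescaled by \<open>1 / p = 2 * Y\<close>.\<close>
  define w where "w i = w1 i + 2 * Y * w2 i" for i
  have supp: "{i. w i \<noteq> 0} \<subseteq> {i. w1 i \<noteq> 0} \<union> {i. w2 i \<noteq> 0}" by (auto simp: w_def)
  have fin1: "finite {i. w1 i \<noteq> 0}" "finite {i. w2 i \<noteq> 0}"
    using w1(2) w2(2) TS R(1) finS finA by (meson finite_subset)+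
  have "card {i. w i \<noteq> 0} \<le> card {i. w1 i \<noteq> 0} + card {i. w2 i \<noteq> 0}"
    using card_mono[OF finite_UnI[OF fin1] supp] card_Un_le[of "{i. w1 i \<noteq> 0}" "{i. w2 i \<noteq> 0}"]
    by linarith
  then have card: "real (card {i. w i \<noteq> 0}) \<le> 2 ^ Suc k * (8 * l * B)"
    using w1(3) w2(3) by simp
  have approx: "(1 - \<delta>) ^ Suc k * real (card (S \<inter> c)) \<le> sum w c \<and>
      sum w c \<le> (1 + \<delta>) ^ Suc k * real (card (S \<inter> c))" if c: "c \<in> C" for c
  proof -
    \<comment> \<open>The removed part \<open>x\<close> enters the recursion exactly, and the
      sampled part \<open>y\<close> is replaced by \<open>z\<close>, within a factor 1 +- \<delta>.
      So passing to \<open>x + z\<close> costs one such factor and the recursion the other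
      \<open>k\<close>.\<close>
    define x y where "x = real (card (T \<inter> c))" and "y = real (card (A \<inter> c))"
    define z where "z = 2 * Y * real (card (R \<inter> c))"
    have xy: "0 \<le> x" "0 \<le> y" by (simp_all add: x_def y_def)
    have "S \<inter> c = (T \<inter> c) \<union> (A \<inter> c)" using TS by (auto simp: A_def)
    moreover have "finite (T \<inter> c)" "finite (A \<inter> c)" "(T \<inter> c) \<inter> (A \<inter> c) = {}"
      using finS TS finA by (auto simp: A_def intro: finite_subset)
    ultimately have S_eq: "real (card (S \<inter> c)) = x + y"
      unfolding x_def y_def by (simp add: card_Un_disjoint)
    have w_eq: "sum w c = sum w1 c + 2 * Y * sum w2 c"
      by (simp add: w_def sum.distrib sum_distrib_left)
    have mem: "c \<inter> A \<in> D" using c by (simp add: D_eq)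
    have Rc: "R \<inter> (c \<inter> A) = R \<inter> c" using R(1) by auto
    have "(1 - \<delta>) * (p * y) \<le> real (card (R \<inter> c))" "real (card (R \<inter> c)) \<le> (1 + \<delta>) * (p * y)"
      using R(3,4)[OF mem] unfolding Rc y_def by (simp_all add: Int_commute)
    then have "2 * Y * ((1 - \<delta>) * (p * y)) \<le> z" "z \<le> 2 * Y * ((1 + \<delta>) * (p * y))"
      unfolding z_def using Y by (auto intro!: mult_left_mono)
    then have z: "(1 - \<delta>) * y \<le> z" "z \<le> (1 + \<delta>) * y"
      using Y by (simp_all add: p_def)
    have low: "(1 - \<delta>) ^ k * (x + z) \<le> sum w c" and up: "sum w c \<le> (1 + \<delta>) ^ k * (x + z)"
    proof -
      have "2 * Y * ((1 - \<delta>) ^ k * real (card (R \<inter> c))) \<le> 2 * Y * sum w2 c"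
        "2 * Y * sum w2 c \<le> 2 * Y * ((1 + \<delta>) ^ k * real (card (R \<inter> c)))"
        using w2(4) c Y by (auto intro!: mult_left_mono)
      moreover have "(1 - \<delta>) ^ k * x \<le> sum w1 c" "sum w1 c \<le> (1 + \<delta>) ^ k * x"
        using w1(4) c by (auto simp: x_def)
      ultimately show "(1 - \<delta>) ^ k * (x + z) \<le> sum w c" "sum w c \<le> (1 + \<delta>) ^ k * (x + z)"
        unfolding w_eq z_def by (simp_all add: algebra_simps)
    qed
    have \<delta>x: "0 \<le> \<delta> * x" using xy \<delta> by simp
    have "(1 - \<delta>) * (x + y) \<le> x + z"
      using z(1) \<delta>x unfolding distrib_left left_diff_distrib by linarith
    then have "(1 - \<delta>) ^ k * ((1 - \<delta>) * (x + y)) \<le> (1 - \<delta>) ^ k * (x + z)"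
      using \<delta> by (intro mult_left_mono) auto
    moreover have "x + z \<le> (1 + \<delta>) * (x + y)"
      using z(2) \<delta>x unfolding distrib_left distrib_right by linarith
    then have "(1 + \<delta>) ^ k * (x + z) \<le> (1 + \<delta>) ^ k * ((1 + \<delta>) * (x + y))"
      using \<delta> by (intro mult_left_mono) auto
    ultimately show ?thesis using low up unfolding S_eq by (simp add: mult_ac)
  qed
  have "{i. w i \<noteq> 0} \<subseteq> S" using supp w1(2) w2(2) TS R(1) unfolding A_def by blast
  moreover have "\<forall>i. 0 \<le> w i" using w1(1) w2(1) Y by (simp add: w_def)
  ultimately show ?case using card approx unfolding l_def by blast
qed

section \<open>Choice of parameters and the final bound\<close>

text \<open>The power is compared with \<open>exp (\<epsilon> / 2)\<close>; halving \<epsilon>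
  leaves room for the quadratic term of the exponential.\<close>

lemma one_plus_power_le:
  fixes \<epsilon> :: real
  assumes "0 < \<epsilon>" "\<epsilon> < 1" "1 \<le> k"
  shows "(1 + \<epsilon> / (2 * real k)) ^ k \<le> 1 + \<epsilon>"
proof -
  have "(1 + \<epsilon> / (2 * real k)) ^ k \<le> exp (\<epsilon> / (2 * real k)) ^ k"
    using assms by (intro power_mono exp_ge_add_one_self) auto
  also have "\<dots> = exp (\<epsilon> / 2)"
    using assms(3) by (subst exp_of_nat_mult[symmetric]) simp
  also have "\<dots> \<le> 1 + \<epsilon> / 2 + (\<epsilon> / 2)\<^sup>2"
    using assms by (intro exp_bound) auto
  also have "(\<epsilon> / 2)\<^sup>2 \<le> \<epsilon> / 2"
    using assms by (simp add: power2_eq_square field_simps)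
  finally show ?thesis by simp
qed

lemma one_minus_power_ge:
  fixes \<epsilon> :: real
  assumes "0 < \<epsilon>" "\<epsilon> < 1" "1 \<le> k"
  shows "1 - \<epsilon> \<le> (1 - \<epsilon> / (2 * real k)) ^ k"
proof -
  have "\<epsilon> / (2 * real k) \<le> 1" using assms by (simp add: field_simps)
  then have "1 + real k * (- (\<epsilon> / (2 * real k))) \<le> (1 + - (\<epsilon> / (2 * real k))) ^ k"
    by (intro Bernoulli_inequality) simp
  moreover have "real k * (\<epsilon> / (2 * real k)) = \<epsilon> / 2" using assms(3) by simp
  ultimately show ?thesis using assms(1) by simp
qed

text \<open>Provides the number of levels: after \<open>k\<close> square roots a ratio of at most
  \<open>2 ^ 2 ^ k\<close> falls to at most 2. Rounding up costs a factor 2 in \<open>2 ^ k\<close>,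
  and the lower limit 1 in \<open>lg\<close> another factor 2.\<close>

lemma log_log_exponent:
  fixes m :: nat
  assumes "1 \<le> m"
  obtains k :: nat where "1 \<le> k" "real m \<le> 2 ^ 2 ^ k" "2 ^ k \<le> 4 * lg (real m)"
    "real k \<le> 2 * lg (lg (real m))"
proof -
  let ?L = "lg (real m)"
  define k where "k = nat \<lceil>lg ?L\<rceil>"
  have L: "1 \<le> ?L" "log 2 (real m) \<le> ?L" "1 \<le> lg ?L" "log 2 ?L \<le> lg ?L" by (simp_all add: lg_def)
  have k: "lg ?L \<le> real k" "real k \<le> lg ?L + 1" using L(3) unfolding k_def by linarith+
  have "1 \<le> k" using k(1) L(3) by linarith
  have "?L = 2 powr log 2 ?L" using L(1) by simp
  also have "\<dots> \<le> 2 powr real k" using L(4) k(1) by (intro powr_mono) auto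
  finally have Lk: "?L \<le> real (2 ^ k)" by (simp add: powr_realpow)
  have "real m = 2 powr log 2 (real m)" using assms by simp
  also have "\<dots> \<le> 2 powr real (2 ^ k)" using L(2) Lk by (intro powr_mono) auto
  also have "\<dots> = 2 ^ 2 ^ k" by (rule powr_realpow) simp
  finally have "real m \<le> 2 ^ 2 ^ k" .
  have "(2::real) ^ k = 2 powr real k" by (simp add: powr_realpow)
  also have "\<dots> \<le> 2 powr (lg ?L + 1)" using k(2) by (intro powr_mono) auto
  also have "\<dots> = 2 * 2 powr (max (log 2 ?L) 1)" by (simp add: powr_add lg_def[of ?L])
  also have "\<dots> \<le> 2 * (2 * ?L)"
    using L(1) by (simp add: max_def)
  finally have "2 ^ k \<le> 4 * ?L" by simp
  then show ?thesis using that[of k] k(2) L(3) \<open>1 \<le> k\<close> \<open>real m \<le> 2 ^ 2 ^ k\<close> by simp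
qed

lemma ln_plus_one_le_lg:
  fixes m :: nat
  assumes "1 \<le> m"
  shows "ln (real m + 1) \<le> 2 * lg (real m)"
proof -
  have "ln (real m + 1) \<le> ln (2 * real m)" using assms by simp
  also have "\<dots> = ln 2 + ln (real m)" using assms by (simp add: ln_mult)
  also have "ln (real m) = ln 2 * log 2 (real m)" by (simp add: log_def)
  also have "ln 2 + ln 2 * log 2 (real m) \<le> 1 * lg (real m) + 1 * lg (real m)"
  proof (rule add_mono)
    have ln2: "0 \<le> ln (2::real)" "ln (2::real) \<le> 1" using ln_le_minus_one[of "2::real"] by simp_all
    show "ln 2 \<le> 1 * lg (real m)" using ln2 by (simp add: lg_def)
    show "ln 2 * log 2 (real m) \<le> 1 * lg (real m)"
      using ln2 assms by (intro mult_mono) (auto simp: lg_def)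
  qed
  finally show ?thesis by simp
qed

lemma sparsifier_exists:
  fixes \<epsilon> :: real and m :: nat
  assumes code: "is_code m C" and \<epsilon>: "0 < \<epsilon>" "\<epsilon> < 1" and m: "1 \<le> m" and cl: "1 \<le> cl C"
  obtains w where "is_sparsifier m C (\<lambda>_. 1) \<epsilon> w"
    "real (card (supp_w m w)) \<le> 32768 * real (cl C) * (lg (real m))\<^sup>2 * (lg (lg (real m)))\<^sup>2 / \<epsilon>\<^sup>2"
proof -
  obtain k where k: "1 \<le> k" "real m \<le> 2 ^ 2 ^ k" "2 ^ k \<le> 4 * lg (real m)"
    "real k \<le> 2 * lg (lg (real m))"
    using log_log_exponent[OF m] .
  \<comment> \<open>The error is spread over \<open>k\<close> levels, with the spare factor 2 of
    \<open>one_plus_power_le\<close>; \<open>B\<close> is the least value that meets the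
    rate.\<close>
  define \<delta> B where "\<delta> = \<epsilon> / (2 * real k)" and "B = 32 * ln (real m + 1) / \<delta>\<^sup>2"
  have \<delta>: "0 < \<delta>" "\<delta> < 1" using k(1) \<epsilon> by (auto simp: \<delta>_def field_simps)
  have rate: "32 * ln (real m + 1) = B * \<delta>\<^sup>2" using \<delta> by (simp add: B_def)
  have "2 \<le> 32 * ln (real m + 1)"
  proof -
    have "ln 2 \<le> ln (real m + 1)" using m by simp
    moreover have "1 / 2 \<le> ln (2::real)" using ln_le_minus_one[of "1 / 2 :: real"] by (simp add: ln_div)
    ultimately show ?thesis by linarith
  qed
  also have "\<dots> \<le> B"
  proof -
    have "\<delta>\<^sup>2 \<le> 1" using \<delta> by (simp add: power_le_one)
    then show ?thesis using \<delta> m by (simp add: B_def field_simps mult_left_le)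
  qed
  finally have B: "2 \<le> B" .
  \<comment> \<open>The recursion may start from all coordinates: \<open>m \<le> 2 ^ 2 ^ k\<close>,
    and the remaining factor is at least 1.\<close>
  have le: "real (card {..<m}) \<le> 4 * real (cl C) * B * 2 ^ 2 ^ k"
  proof -
    have "1 * 2 \<le> real (cl C) * B" using cl B by (intro mult_mono) auto
    then have "1 * 2 ^ 2 ^ k \<le> 4 * real (cl C) * B * 2 ^ 2 ^ k"
      by (intro mult_right_mono) auto
    then show ?thesis using k(2) unfolding card_lessThan by linarith
  qed
  have sub: "\<Union>C \<subseteq> {..<m}" using code by (auto simp: is_code_def)
  obtain w where w: "\<forall>i. 0 \<le> w i" "{i. w i \<noteq> 0} \<subseteq> {..<m}"
    "real (card {i. w i \<noteq> 0}) \<le> 2 ^ k * (8 * real (cl C) * B)"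
    "\<forall>c\<in>C. (1 - \<delta>) ^ k * real (card ({..<m} \<inter> c)) \<le> sum w c \<and>
            sum w c \<le> (1 + \<delta>) ^ k * real (card ({..<m} \<inter> c))"
    using sparsify_iterated[OF finite_lessThan sub _ m cl \<delta> B _ order_refl le] rate by auto
  show ?thesis
  proof (rule that[of w])
    show "is_sparsifier m C (\<lambda>_. 1) \<epsilon> w"
      unfolding is_sparsifier_def
    proof (intro conjI ballI allI impI)
      fix c assume c: "c \<in> C"
      have eq: "{..<m} \<inter> c = c" using c sub by auto
      have "(1 - \<epsilon>) * real (card c) \<le> (1 - \<delta>) ^ k * real (card c)"
        unfolding \<delta>_def using one_minus_power_ge[OF \<epsilon> k(1)] by (intro mult_right_mono) auto
      also have "\<dots> \<le> sum w c" using w(4) c by (auto simp: eq)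
      finally show "(1 - \<epsilon>) * wsum m (\<lambda>_. 1) c \<le> wsum m w c" by (simp add: wsum_def eq)
      have "sum w c \<le> (1 + \<delta>) ^ k * real (card c)" using w(4) c by (auto simp: eq)
      also have "\<dots> \<le> (1 + \<epsilon>) * real (card c)"
        unfolding \<delta>_def using one_plus_power_le[OF \<epsilon> k(1)] by (intro mult_right_mono) auto
      finally show "wsum m w c \<le> (1 + \<epsilon>) * wsum m (\<lambda>_. 1) c" by (simp add: wsum_def eq)
    qed (use w(1) in auto)
    have "supp_w m w = {i. w i \<noteq> 0}" using w(2) by (auto simp: supp_w_def)
    then have "real (card (supp_w m w)) \<le> 2 ^ k * (8 * real (cl C) * B)" using w(3) by simp
    \<comment> \<open>A factor 4 comes from \<open>2 ^ k\<close>, 8 from the base case, and 1024 =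
      32 * 4 * 2 * 4 from the rate, the squared 2 in \<delta>, the logarithm and
      \<open>k\<^sup>2\<close>; together 32768.\<close>
    also have "\<dots> \<le> (4 * lg (real m)) * (8 * real (cl C) * (1024 * lg (real m) * (lg (lg (real m)))\<^sup>2 / \<epsilon>\<^sup>2))"
    proof (intro mult_mono)
      have "B = 128 * (ln (real m + 1) * (real k)\<^sup>2) / \<epsilon>\<^sup>2"
        using k(1) \<epsilon> by (simp add: B_def \<delta>_def power_divide power_mult_distrib)
      also have "\<dots> \<le> 128 * ((2 * lg (real m)) * (2 * lg (lg (real m)))\<^sup>2) / \<epsilon>\<^sup>2"
        using ln_plus_one_le_lg[OF m] k(4)
        by (intro divide_right_mono mult_left_mono mult_mono power_mono) (auto simp: lg_def)
      also have "\<dots> = 1024 * lg (real m) * (lg (lg (real m)))\<^sup>2 / \<epsilon>\<^sup>2"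
        by (simp add: power_mult_distrib)
      finally show "B \<le> 1024 * lg (real m) * (lg (lg (real m)))\<^sup>2 / \<epsilon>\<^sup>2" .
    qed (use k(3) B in \<open>auto simp: lg_def\<close>)
    also have "\<dots> = 32768 * real (cl C) * (lg (real m))\<^sup>2 * (lg (lg (real m)))\<^sup>2 / \<epsilon>\<^sup>2"
      by (simp add: power2_eq_square)
    finally show "real (card (supp_w m w)) \<le> \<dots>" .
  qed
qed

theorem theorem4p1:
  "\<exists>K::real. \<forall>(m::nat) (C::nat set set) (\<epsilon>::real).
     is_code m C \<longrightarrow> 0 < \<epsilon> \<longrightarrow> \<epsilon> < 1 \<longrightarrow>
     (\<exists>w'. is_sparsifier m C (\<lambda>_. 1) \<epsilon> w' \<and>
        real (card (supp_w m w')) \<le>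
          K * real (chain_length m C) * (lg (real m))^2 * (lg (lg (real m)))^2 / \<epsilon>^2)"
proof (intro exI[of _ 32768] allI impI)
  fix m :: nat and C :: "nat set set" and \<epsilon> :: real
  assume code: "is_code m C" and \<epsilon>: "0 < \<epsilon>" "\<epsilon> < 1"
  have sub: "\<Union>C \<subseteq> {..<m}" using code by (auto simp: is_code_def)
  have finC: "finite C" using sub by (auto intro: finite_subset[of _ "Pow {..<m}"])
  show "\<exists>w'. is_sparsifier m C (\<lambda>_. 1) \<epsilon> w' \<and>
        real (card (supp_w m w')) \<le>
          32768 * real (chain_length m C) * (lg (real m))^2 * (lg (lg (real m)))^2 / \<epsilon>^2"
  \<comment> \<open>Codes without a nonempty word get zero weights, since
    \<open>sparsifier_exists\<close> asks for \<open>cl C \<ge> 1\<close>.\<close>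
  proof (cases "C \<subseteq> {{}}")
    case True
    then have "is_sparsifier m C (\<lambda>_. 1) \<epsilon> (\<lambda>_. 0)" by (auto simp: is_sparsifier_def wsum_def)
    then show ?thesis by (intro exI[of _ "\<lambda>_. 0"]) (simp add: supp_w_def)
  next
    case False
    then obtain c where c: "c \<in> C" "c \<noteq> {}" by auto
    have cl: "1 \<le> cl C" by (rule cl_pos[OF finC c])
    have m: "1 \<le> m" using c sub by (cases m) auto
    obtain w where w: "is_sparsifier m C (\<lambda>_. 1) \<epsilon> w"
      "real (card (supp_w m w)) \<le> 32768 * real (cl C) * (lg (real m))\<^sup>2 * (lg (lg (real m)))\<^sup>2 / \<epsilon>\<^sup>2"
      using sparsifier_exists[OF code \<epsilon> m cl] .
    note w(2)
    also have "32768 * real (cl C) * (lg (real m))\<^sup>2 * (lg (lg (real m)))\<^sup>2 / \<epsilon>\<^sup>2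
        \<le> 32768 * real (chain_length m C) * (lg (real m))\<^sup>2 * (lg (lg (real m)))\<^sup>2 / \<epsilon>\<^sup>2"
      using cl_le_chain_length[OF code]
      by (intro divide_right_mono mult_right_mono mult_left_mono) auto
    finally show ?thesis using w(1) by blast
  qed
qed

end
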